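(* Consider a contextual game with $N$ players, finite action sets $\mathcal{A}^1,\dots,\mathcal{A}^N$, context set $\mathcal{Z}$, reward functions $r^i:\bm{\mathcal{A}}\times\mathcal{Z}\to[0,1]$, and social welfare $\Gamma:\bm{\mathcal{A}}\times\mathcal{Z}\to\mathbb{R}$ with $\Gamma(\mathbf{a},z)\ge\sum_{i=1}^N r^i(\mathbf{a},z)$ for all $(\mathbf{a},z)$. Suppose that in $T$ rounds the contexts $z_1,\dots,z_T$ were revealed and the joint actions $\mathbf{a}_t=(a_t^1,\dots,a_t^N)$, $t=1,\dots,T$, were played, and let $R_c^i(T)$ be the players' contextual regrets. Assume that the game is $(\lambda(z_t),\mu(z_t))$-smooth at each time $t$. Let $\bar\lambda=\min_{t\in\{1,\dots,T\}}\lambda(z_t)$ and $\bar\mu=\max_{t\in\{1,\dots,T\}}\mu(z_t)$, with $1+\bar\mu>0$. Then $$\frac1T\sum_{t=1}^T\Gamma(a_t^1,\dots,a_t^N,z_t)\ \ge\ \frac{\bar\lambda}{1+\bar\mu}\,\mathrm{OPT}-\frac{1}{1+\bar\mu}\sum_{i=1}^N\frac{R_c^i(T)}{T}.$$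
   Context: $\bm{\mathcal{A}}=\mathcal{A}^1\times\dots\times\mathcal{A}^N$; $a^{-i}$ denotes the actions of the players other than $i$. Contextual regret of player $i$: $R_c^i(T)=\max_{\pi:\mathcal{Z}\to\mathcal{A}^i}\sum_{t=1}^T r^i(\pi(z_t),a_t^{-i},z_t)-\sum_{t=1}^T r^i(a_t^i,a_t^{-i},z_t)$. Optimal contextual welfare: $\mathrm{OPT}=\max_{\pi^1,\dots,\pi^N}\frac1T\sum_{t=1}^T\Gamma(\pi^1(z_t),\dots,\pi^N(z_t),z_t)$, the maximum being over all policies $\pi^j:\mathcal{Z}\to\mathcal{A}^j$. Smoothness: for a context $z$, the game is $(\lambda(z),\mu(z))$-smooth if for every pair of outcomes $\mathbf{a}_1=(a_1^1,\dots,a_1^N)$, $\mathbf{a}_2=(a_2^1,\dots,a_2^N)$ in $\bm{\mathcal{A}}$, $\sum_{i=1}^N r^i(a_2^i,a_1^{-i},z)\ge\lambda(z)\,\Gamma(\mathbf{a}_2,z)-\mu(z)\,\Gamma(\mathbf{a}_1,z)$; being smooth at time $t$ means this holds for $z=z_t$. *)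

theory Defs
  imports Complex_Main "HOL-Library.FuncSet"
begin

text \<open>
  The players are \<open>1, \<dots>, N\<close>, and the action sets \<open>A i\<close> are arbitrary sets in a common type.
  Outcomes are extensional functions on the players, so the profile \<open>(x, a\<^sup>-\<^sup>i)\<close> is the
  function update \<open>a(i := x)\<close>.
\<close>

definition outcomes :: "nat \<Rightarrow> (nat \<Rightarrow> 'a set) \<Rightarrow> (nat \<Rightarrow> 'a) set" where
  "outcomes N A = (\<Pi>\<^sub>E i\<in>{1..N}. A i)"

definition policies :: "'z set \<Rightarrow> 'a set \<Rightarrow> ('z \<Rightarrow> 'a) set" where
  "policies Z B = (Z \<rightarrow>\<^sub>E B)"

text \<open>
  In the next two definitions there may be infinitely many policies, but the values depend only on
  the actions chosen at the finitely many contexts \<open>z 1, \<dots>, z T\<close>. So for finite action sets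
  \<open>Max\<close> is taken over a finite set, which is nonempty as soon as the action sets are.
\<close>

definition contextual_regret ::
  "(nat \<Rightarrow> 'a set) \<Rightarrow> 'z set \<Rightarrow> (nat \<Rightarrow> (nat \<Rightarrow> 'a) \<Rightarrow> 'z \<Rightarrow> real) \<Rightarrow>
   (nat \<Rightarrow> nat \<Rightarrow> 'a) \<Rightarrow> (nat \<Rightarrow> 'z) \<Rightarrow> nat \<Rightarrow> nat \<Rightarrow> real" where
  "contextual_regret A Z r a z T i =
     Max ((\<lambda>\<pi>. \<Sum>t=1..T. r i ((a t)(i := \<pi> (z t))) (z t)) ` policies Z (A i))
       - (\<Sum>t=1..T. r i (a t) (z t))"

definition opt_contextual_welfare ::
  "nat \<Rightarrow> (nat \<Rightarrow> 'a set) \<Rightarrow> 'z set \<Rightarrow> ((nat \<Rightarrow> 'a) \<Rightarrow> 'z \<Rightarrow> real) \<Rightarrow>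
   (nat \<Rightarrow> 'z) \<Rightarrow> nat \<Rightarrow> real" where
  "opt_contextual_welfare N A Z \<Gamma> z T =
     Max ((\<lambda>\<pi>. 1 / real T * (\<Sum>t=1..T. \<Gamma> (\<lambda>j\<in>{1..N}. \<pi> j (z t)) (z t)))
       ` (\<Pi>\<^sub>E j\<in>{1..N}. policies Z (A j)))"

definition smooth_at ::
  "nat \<Rightarrow> (nat \<Rightarrow> 'a set) \<Rightarrow> (nat \<Rightarrow> (nat \<Rightarrow> 'a) \<Rightarrow> 'z \<Rightarrow> real) \<Rightarrow>
   ((nat \<Rightarrow> 'a) \<Rightarrow> 'z \<Rightarrow> real) \<Rightarrow> real \<Rightarrow> real \<Rightarrow> 'z \<Rightarrow> bool" where
  "smooth_at N A r \<Gamma> l m z \<longleftrightarrow>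
     (\<forall>a1\<in>outcomes N A. \<forall>a2\<in>outcomes N A.
        (\<Sum>i=1..N. r i (a1(i := a2 i)) z) \<ge> l * \<Gamma> a2 z - m * \<Gamma> a1 z)"

end

theory Submission
  imports Defs
begin

text \<open>
  Fix a policy profile attaining the optimal contextual welfare. Up to regret, each player earns at
  least as much as by switching unilaterally to its policy from this profile, and smoothness in
  each round bounds the sum of these deviation rewards from below. The rewards are nonnegative,
  hence so is the welfare; this is what allows replacing the round-dependent smoothness constants
  by their worst values over all rounds.
\<close>

text \<open>There may be infinitely many policies, so finiteness of the sets under
  \<open>Max\<close> cannot come from finiteness of the index set \<open>P\<close>. It comes from
  factoring the value through a map \<open>g\<close> into a finite set \<open>B\<close>.\<close>

lemma finite_image_factor:
  assumes "finite B" "g ` P \<subseteq> B" "\<And>x. x \<in> P \<Longrightarrow> f x = h (g x)"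
  shows "finite (f ` P)"
proof -
  have "f ` P \<subseteq> h ` B"
    using assms(2,3) by auto
  then show ?thesis
    using assms(1) by (meson finite_imageI finite_subset)
qed

lemma policy_in:
  assumes "\<pi> \<in> policies Z B" "y \<in> Z"
  shows "\<pi> y \<in> B"
  using assms by (auto simp: policies_def)

text \<open>The total reward of a deviation depends on \<open>\<pi>\<close> only through the actions
  \<open>\<pi> (z t)\<close> in the \<open>T\<close> rounds. This leaves finitely many values, so
  \<open>Max\<close> is a genuine upper bound for each of them.\<close>

lemma contextual_regret_ge:
  assumes "finite (A i)" "\<And>t. t \<in> {1..T} \<Longrightarrow> z t \<in> Z" "\<pi> \<in> policies Z (A i)"
  shows "contextual_regret A Z r a z T i
    \<ge> (\<Sum>t=1..T. r i ((a t)(i := \<pi> (z t))) (z t)) - (\<Sum>t=1..T. r i (a t) (z t))"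
proof -
  let ?h = "\<lambda>c. \<Sum>t=1..T. r i ((a t)(i := c t)) (z t)"
  have "finite ((\<lambda>\<pi>. ?h (\<lambda>t. \<pi> (z t))) ` policies Z (A i))"
  proof (rule finite_image_factor[where h = ?h])
    show "finite (\<Pi>\<^sub>E t\<in>{1..T}. A i)"
      using assms(1) by (intro finite_PiE) auto
    \<comment> \<open>Restricting to \<open>{1..T}\<close> lands in a finite extensional function
      space, and the sum in \<open>?h\<close> does not see the restriction.\<close>
    show "(\<lambda>\<pi>. \<lambda>t\<in>{1..T}. \<pi> (z t)) ` policies Z (A i) \<subseteq> (\<Pi>\<^sub>E t\<in>{1..T}. A i)"
      using assms(2) by (auto simp: policy_in)
  qed (auto intro!: sum.cong)
  then show ?thesis
    using assms(3) by (auto simp: contextual_regret_def intro!: Max_ge)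
qed

text \<open>The welfare of a policy profile factors through the outcomes it prescribes in the
  \<open>T\<close> rounds, so it takes finitely many values. Nonempty action sets provide at least
  one profile, hence \<open>Max\<close> is attained.\<close>

lemma opt_contextual_welfare_attained:
  assumes fin: "\<And>i. i \<in> {1..N} \<Longrightarrow> finite (A i)"
    and nonempty: "\<And>i. i \<in> {1..N} \<Longrightarrow> A i \<noteq> {}"
    and contexts: "\<And>t. t \<in> {1..T} \<Longrightarrow> z t \<in> Z"
  obtains \<pi> where "\<And>j. j \<in> {1..N} \<Longrightarrow> \<pi> j \<in> policies Z (A j)"
    and "opt_contextual_welfare N A Z \<Gamma> z T
      = 1 / real T * (\<Sum>t=1..T. \<Gamma> (\<lambda>j\<in>{1..N}. \<pi> j (z t)) (z t))"
proof -
  let ?P = "\<Pi>\<^sub>E j\<in>{1..N}. policies Z (A j)"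
  let ?h = "\<lambda>c. 1 / real T * (\<Sum>t=1..T. \<Gamma> (c t) (z t))"
  let ?f = "\<lambda>\<pi>. ?h (\<lambda>t. \<lambda>j\<in>{1..N}. \<pi> j (z t))"
  have "finite (?f ` ?P)"
  proof (rule finite_image_factor[where h = ?h])
    show "finite (\<Pi>\<^sub>E t\<in>{1..T}. outcomes N A)"
      using fin by (intro finite_PiE) (auto simp: outcomes_def intro!: finite_PiE)
    show "(\<lambda>\<pi>. \<lambda>t\<in>{1..T}. \<lambda>j\<in>{1..N}. \<pi> j (z t)) ` ?P \<subseteq> (\<Pi>\<^sub>E t\<in>{1..T}. outcomes N A)"
    proof (rule image_subsetI)
      fix \<pi>
      assume "\<pi> \<in> ?P"
      then have "\<pi> j (z t) \<in> A j" if "j \<in> {1..N}" "t \<in> {1..T}" for j t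
        using that contexts policy_in PiE_mem by metis
      then show "(\<lambda>t\<in>{1..T}. \<lambda>j\<in>{1..N}. \<pi> j (z t)) \<in> (\<Pi>\<^sub>E t\<in>{1..T}. outcomes N A)"
        by (simp add: outcomes_def restrict_PiE_iff)
    qed
  qed (auto intro!: sum.cong)
  moreover have "?P \<noteq> {}"
    using nonempty by (auto simp: PiE_eq_empty_iff policies_def)
  ultimately have "Max (?f ` ?P) \<in> ?f ` ?P"
    by (intro Max_in) auto
  then obtain \<pi> where "\<pi> \<in> ?P" "Max (?f ` ?P) = ?f \<pi>"
    by auto
  then show thesis
    by (intro that[of \<pi>]) (auto simp: opt_contextual_welfare_def)
qed

theorem proposition6:
  fixes N T :: nat
    and A :: "nat \<Rightarrow> 'a set"
    and Z :: "'z set"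
    and r :: "nat \<Rightarrow> (nat \<Rightarrow> 'a) \<Rightarrow> 'z \<Rightarrow> real"
    and \<Gamma> :: "(nat \<Rightarrow> 'a) \<Rightarrow> 'z \<Rightarrow> real"
    and z :: "nat \<Rightarrow> 'z"
    and a :: "nat \<Rightarrow> nat \<Rightarrow> 'a"
    and lam mu :: "'z \<Rightarrow> real"
    and lambar mubar :: real
  assumes finite_actions: "\<And>i. i \<in> {1..N} \<Longrightarrow> finite (A i)"
    and reward_range: "\<And>i b y. i \<in> {1..N} \<Longrightarrow> b \<in> outcomes N A \<Longrightarrow> y \<in> Z \<Longrightarrow> r i b y \<in> {0..1}"
    and welfare: "\<And>b y. b \<in> outcomes N A \<Longrightarrow> y \<in> Z \<Longrightarrow> \<Gamma> b y \<ge> (\<Sum>i=1..N. r i b y)"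
    and rounds: "T \<ge> 1"
    and contexts: "\<And>t. t \<in> {1..T} \<Longrightarrow> z t \<in> Z"
    and actions: "\<And>t. t \<in> {1..T} \<Longrightarrow> a t \<in> outcomes N A"
    and smooth: "\<And>t. t \<in> {1..T} \<Longrightarrow> smooth_at N A r \<Gamma> (lam (z t)) (mu (z t)) (z t)"
    and lambar: "lambar = Min ((\<lambda>t. lam (z t)) ` {1..T})"
    and mubar: "mubar = Max ((\<lambda>t. mu (z t)) ` {1..T})"
    and pos: "1 + mubar > 0"
  shows "1 / real T * (\<Sum>t=1..T. \<Gamma> (a t) (z t))
    \<ge> lambar / (1 + mubar) * opt_contextual_welfare N A Z \<Gamma> z T
      - 1 / (1 + mubar) * (\<Sum>i=1..N. contextual_regret A Z r a z T i / real T)"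
proof -
  have nonneg: "\<Gamma> b y \<ge> 0" if "b \<in> outcomes N A" "y \<in> Z" for b y
  proof -
    have "0 \<le> (\<Sum>i=1..N. r i b y)"
      using reward_range that by (intro sum_nonneg) auto
    then show ?thesis
      using welfare[OF that] by linarith
  qed
  have nonempty: "A i \<noteq> {}" if "i \<in> {1..N}" for i
    \<comment> \<open>The action played in round 1, which exists since \<open>T \<ge> 1\<close>, is
      a witness.\<close>
    using actions[of 1] rounds that by (auto simp: outcomes_def)
  obtain \<pi> where \<pi>: "\<And>j. j \<in> {1..N} \<Longrightarrow> \<pi> j \<in> policies Z (A j)"
    and opt: "opt_contextual_welfare N A Z \<Gamma> z T
      = 1 / real T * (\<Sum>t=1..T. \<Gamma> (\<lambda>j\<in>{1..N}. \<pi> j (z t)) (z t))"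
    using opt_contextual_welfare_attained[of N A T z Z \<Gamma>, OF finite_actions nonempty contexts]
    by blast
  \<comment> \<open>\<open>b t\<close> is the outcome that the optimal profile prescribes in round
    \<open>t\<close>; it serves as the second outcome in the smoothness inequality, with
    \<open>a t\<close> as the first.\<close>
  define b where "b t = (\<lambda>j\<in>{1..N}. \<pi> j (z t))" for t
  have b: "b t \<in> outcomes N A" if "t \<in> {1..T}" for t
    using policy_in[OF \<pi>] contexts[OF that] by (auto simp: b_def outcomes_def)
  define W where "W = (\<Sum>t=1..T. \<Gamma> (a t) (z t))"
  define V where "V = (\<Sum>t=1..T. \<Gamma> (b t) (z t))"
  define R where "R = (\<Sum>i=1..N. contextual_regret A Z r a z T i)"

  have round: "lambar * \<Gamma> (b t) (z t) - mubar * \<Gamma> (a t) (z t)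
      \<le> (\<Sum>i=1..N. r i ((a t)(i := b t i)) (z t))" if t: "t \<in> {1..T}" for t
  proof -
    have "lambar * \<Gamma> (b t) (z t) \<le> lam (z t) * \<Gamma> (b t) (z t)"
      using t nonneg[OF b[OF t] contexts[OF t]] by (intro mult_right_mono) (auto simp: lambar)
    moreover have "mu (z t) * \<Gamma> (a t) (z t) \<le> mubar * \<Gamma> (a t) (z t)"
      using t nonneg[OF actions[OF t] contexts[OF t]] by (intro mult_right_mono) (auto simp: mubar)
    moreover have "lam (z t) * \<Gamma> (b t) (z t) - mu (z t) * \<Gamma> (a t) (z t)
        \<le> (\<Sum>i=1..N. r i ((a t)(i := b t i)) (z t))"
      using smooth[OF t] actions[OF t] b[OF t] by (auto simp: smooth_at_def)
    ultimately show ?thesis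
      by linarith
  qed
  have "lambar * V - mubar * W
      = (\<Sum>t=1..T. lambar * \<Gamma> (b t) (z t) - mubar * \<Gamma> (a t) (z t))"
    by (simp add: V_def W_def sum_distrib_left sum_subtractf)
  also have "\<dots> \<le> (\<Sum>t=1..T. \<Sum>i=1..N. r i ((a t)(i := b t i)) (z t))"
    using round by (rule sum_mono)
  \<comment> \<open>With the players outermost, each inner sum is the total reward of one player
    deviating to a single fixed policy, which is what regret compares against.\<close>
  also have "\<dots> = (\<Sum>i=1..N. \<Sum>t=1..T. r i ((a t)(i := \<pi> i (z t))) (z t))"
    by (subst sum.swap) (simp add: b_def)
  also have "\<dots> \<le> (\<Sum>i=1..N. contextual_regret A Z r a z T i + (\<Sum>t=1..T. r i (a t) (z t)))"
  proof (rule sum_mono)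
    fix i
    assume "i \<in> {1..N}"
    then show "(\<Sum>t=1..T. r i ((a t)(i := \<pi> i (z t))) (z t))
        \<le> contextual_regret A Z r a z T i + (\<Sum>t=1..T. r i (a t) (z t))"
      using contextual_regret_ge[of A i T z Z "\<pi> i" r a] finite_actions contexts \<pi>
      by (simp add: algebra_simps)
  qed
  also have "\<dots> = R + (\<Sum>t=1..T. \<Sum>i=1..N. r i (a t) (z t))"
    by (simp add: R_def sum.distrib) (rule sum.swap)
  also have "\<dots> \<le> R + W"
    unfolding W_def using welfare actions contexts by (intro add_left_mono sum_mono) auto
  \<comment> \<open>The term \<open>mubar * W\<close> moves to the right and joins the
    \<open>W\<close> that bounds the collected rewards, which is the origin of the factor
    \<open>1 + mubar\<close>.\<close>
  finally have "lambar * V - R \<le> (1 + mubar) * W"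
    by (simp add: algebra_simps)
  then have "(lambar * V - R) / (1 + mubar) / real T \<le> W / real T"
    using pos by (intro divide_right_mono) (simp_all add: pos_divide_le_eq mult.commute)
  moreover have "lambar / (1 + mubar) * opt_contextual_welfare N A Z \<Gamma> z T
      - 1 / (1 + mubar) * (\<Sum>i=1..N. contextual_regret A Z r a z T i / real T)
      = (lambar * V - R) / (1 + mubar) / real T"
    by (simp add: opt V_def R_def b_def sum_divide_distrib[symmetric] diff_divide_distrib)
  ultimately show ?thesis
    by (simp add: W_def)
qed

end
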